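(* Let $P$ be an abstract cubic with collinearity relation $L\subset P\times P\times P$ such that for any $x,y\in P$ there exists $z\in P$ with $(x,y,z)\in L$. Let $\sim_i$ and $\approx_i$ ($i\ge 0$) be the relations on $P$ defined inductively in the context. (a) If $x\approx_i x'$, then $x\approx_{i+1}x'$. (b) Define the equivalence relation $\approx$ on $P$ by: $x\approx x'$ if and only if there exists $i$ with $x\approx_i x'$. Then $\approx$ is admissible and universal.
   Context: An abstract cubic is a set $P$ with a ternary relation $L\subset P\times P\times P$ such that (i) $L$ is invariant under permutations of the factors; (ii) if $(x,y,z),(x,y,z')\in L$ and $x\neq y$, then $z=z'$. An equivalence relation $R$ on $P$ is admissible if the relation $L/R$ induced by $L$ on $P/R$ (the image of $L$) has the property: for any $X,Y\in P/R$ there exists a unique $Z\in P/R$ with $(X,Y,Z)\in L/R$. An admissible equivalence relation is universal if it is finer than any other admissible equivalence relation. Inductive definition: $\sim_0$ and $\approx_0$ are both the identity relation $x=x'$. Given $\sim_i,\approx_i$, put $x\sim_{i+1}x'$ iff $x=x'$ or there exist $u,v,u',v'\in P$ with $u\approx_i u'$, $v\approx_i v'$, $(u,v,x)\in L$ and $(u',v',x')\in L$. Then $\approx_{i+1}$ is the transitive closure of $\sim_{i+1}$: $x\approx_{i+1}x'$ iff there is a sequence $x=y_0,y_1,\dots,y_r=x'$ in $P$ with $y_a\sim_{i+1}y_{a+1}$ for all $a<r$. *)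

theory Defs
  imports Main
begin

definition abstract_cubic :: "'a set \<Rightarrow> ('a \<times> 'a \<times> 'a) set \<Rightarrow> bool" where
  "abstract_cubic P L \<longleftrightarrow>
     L \<subseteq> P \<times> P \<times> P \<and>
     (\<forall>x y z. (x, y, z) \<in> L \<longrightarrow>
        (x, z, y) \<in> L \<and> (y, x, z) \<in> L \<and> (y, z, x) \<in> L \<and> (z, x, y) \<in> L \<and> (z, y, x) \<in> L) \<and>
     (\<forall>x y z z'. (x, y, z) \<in> L \<and> (x, y, z') \<in> L \<and> x \<noteq> y \<longrightarrow> z = z')"

definition quotient_relation ::
  "('a \<times> 'a \<times> 'a) set \<Rightarrow> ('a \<times> 'a) set \<Rightarrow> ('a set \<times> 'a set \<times> 'a set) set" where
  "quotient_relation L R = (\<lambda>(x, y, z). (R `` {x}, R `` {y}, R `` {z})) ` L"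

definition admissible :: "'a set \<Rightarrow> ('a \<times> 'a \<times> 'a) set \<Rightarrow> ('a \<times> 'a) set \<Rightarrow> bool" where
  "admissible P L R \<longleftrightarrow>
     equiv P R \<and>
     (\<forall>X \<in> P // R. \<forall>Y \<in> P // R. \<exists>!Z. Z \<in> P // R \<and> (X, Y, Z) \<in> quotient_relation L R)"

definition universal :: "'a set \<Rightarrow> ('a \<times> 'a \<times> 'a) set \<Rightarrow> ('a \<times> 'a) set \<Rightarrow> bool" where
  "universal P L R \<longleftrightarrow>
     admissible P L R \<and> (\<forall>R'. admissible P L R' \<longrightarrow> R \<subseteq> R')"

(* sim_rel P L i and approx_rel P L i are the i-th relations \<sim> and \<approx>.  Since sim_rel P L i
   is a reflexive relation on P, its transitive closure already accounts for chains of length 0,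
   and all intermediate points of a chain lie in P. *)
fun sim_rel :: "'a set \<Rightarrow> ('a \<times> 'a \<times> 'a) set \<Rightarrow> nat \<Rightarrow> ('a \<times> 'a) set"
  and approx_rel :: "'a set \<Rightarrow> ('a \<times> 'a \<times> 'a) set \<Rightarrow> nat \<Rightarrow> ('a \<times> 'a) set" where
  "sim_rel P L 0 = Id_on P"
| "sim_rel P L (Suc i) =
     {(x, x'). x \<in> P \<and> x' \<in> P \<and>
        (x = x' \<or>
         (\<exists>u\<in>P. \<exists>v\<in>P. \<exists>u'\<in>P. \<exists>v'\<in>P.
            (u, u') \<in> approx_rel P L i \<and> (v, v') \<in> approx_rel P L i \<and>
            (u, v, x) \<in> L \<and> (u', v', x') \<in> L))}"
| "approx_rel P L 0 = Id_on P"
| "approx_rel P L (Suc i) = (sim_rel P L (Suc i))\<^sup>+"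

definition approx_union :: "'a set \<Rightarrow> ('a \<times> 'a \<times> 'a) set \<Rightarrow> ('a \<times> 'a) set" where
  "approx_union P L = {(x, x'). \<exists>i. (x, x') \<in> approx_rel P L i}"

end

theory Submission
  imports Defs
begin

text \<open>
  Call a relation compatible with \<open>L\<close> if collinear triples whose first two entries are related
  have related third entries. When any two points are collinear with some third one, an
  equivalence relation is admissible precisely when it is compatible (\<open>admissible_iff\<close>): the third
  class exists because the third point does, and it is unique because of compatibility.

  Each stage of the construction relates the pairs that compatibility with the previous stage
  demands, and closes the result transitively. The stages increase, so the two pairs of a
  compatibility condition on the union lie in a common stage, and the next stage contains the
  conclusion; hence the union is admissible. Conversely, every compatible equivalence relation contains each stage by induction, so the union
  is the finest admissible relation.
\<close>

text \<open>No equivalence is built into this notion; with \<open>R\<close> an equivalence relation, it says that the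
  relation induced by \<open>L\<close> on the quotient is single-valued in its third component.\<close>

definition compatible :: "('a \<times> 'a \<times> 'a) set \<Rightarrow> ('a \<times> 'a) set \<Rightarrow> bool" where
  "compatible L R \<longleftrightarrow>
     (\<forall>u v x u' v' x'. (u, v, x) \<in> L \<longrightarrow> (u', v', x') \<in> L \<longrightarrow>
        (u, u') \<in> R \<longrightarrow> (v, v') \<in> R \<longrightarrow> (x, x') \<in> R)"

lemma compatibleD:
  assumes "compatible L R" "(u, v, x) \<in> L" "(u', v', x') \<in> L" "(u, u') \<in> R" "(v, v') \<in> R"
  shows "(x, x') \<in> R"
  using assms unfolding compatible_def by blast

lemma quotient_relationI:
  assumes "(x, y, z) \<in> L"
  shows "(R `` {x}, R `` {y}, R `` {z}) \<in> quotient_relation L R"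
  using assms unfolding quotient_relation_def by force

lemma admissible_imp_compatible:
  assumes L: "L \<subseteq> P \<times> P \<times> P" and adm: "admissible P L R"
  shows "compatible L R"
  unfolding compatible_def
proof (intro allI impI)
  fix u v x u' v' x'
  assume l: "(u, v, x) \<in> L" and l': "(u', v', x') \<in> L"
    and u: "(u, u') \<in> R" and v: "(v, v') \<in> R"
  have eq: "equiv P R"
    using adm unfolding admissible_def by blast
  have P: "u \<in> P" "v \<in> P" "x \<in> P" "x' \<in> P"
    using L l l' by auto
  have "(R `` {u}, R `` {v}, R `` {x}) \<in> quotient_relation L R"
    using l by (rule quotient_relationI)
  moreover have "(R `` {u}, R `` {v}, R `` {x'}) \<in> quotient_relation L R"
    using quotient_relationI[OF l', of R] equiv_class_eq[OF eq u] equiv_class_eq[OF eq v] by simp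
  moreover have "\<exists>!Z. Z \<in> P // R \<and> (R `` {u}, R `` {v}, Z) \<in> quotient_relation L R"
    using adm P unfolding admissible_def by (simp add: quotientI)
  moreover have "R `` {x} \<in> P // R" "R `` {x'} \<in> P // R"
    using P by (auto intro: quotientI)
  ultimately have "R `` {x} = R `` {x'}"
    by blast
  then show "(x, x') \<in> R"
    using eq P by (simp add: eq_equiv_class_iff)
qed

lemma compatible_imp_admissible:
  assumes L: "L \<subseteq> P \<times> P \<times> P" and total: "\<forall>x\<in>P. \<forall>y\<in>P. \<exists>z\<in>P. (x, y, z) \<in> L"
    and eq: "equiv P R" and comp: "compatible L R"
  shows "admissible P L R"
  unfolding admissible_def
proof (intro conjI ballI)
  fix X Y assume "X \<in> P // R" "Y \<in> P // R"
  then obtain x y where x: "x \<in> P" "X = R `` {x}" and y: "y \<in> P" "Y = R `` {y}"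
    by (auto elim!: quotientE)
  obtain z where z: "z \<in> P" "(x, y, z) \<in> L"
    using total x y by blast
  show "\<exists>!Z. Z \<in> P // R \<and> (X, Y, Z) \<in> quotient_relation L R"
  proof (rule ex1I[of _ "R `` {z}"])
    show "R `` {z} \<in> P // R \<and> (X, Y, R `` {z}) \<in> quotient_relation L R"
      using z x y quotientI quotient_relationI by fastforce
  next
    fix Z assume "Z \<in> P // R \<and> (X, Y, Z) \<in> quotient_relation L R"
    then obtain a b c where l: "(a, b, c) \<in> L"
      and XYZ: "X = R `` {a}" "Y = R `` {b}" "Z = R `` {c}"
      unfolding quotient_relation_def by auto
    have "a \<in> P" "b \<in> P"
      using L l by auto
    then have "(a, x) \<in> R" "(b, y) \<in> R"
      using eq x y XYZ eq_equiv_class_iff[OF eq] by blast+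
    then have "(c, z) \<in> R"
      using compatibleD[OF comp l z(2)] by blast
    then show "Z = R `` {z}"
      using XYZ equiv_class_eq[OF eq] by simp
  qed
qed (rule eq)

lemma admissible_iff:
  assumes "L \<subseteq> P \<times> P \<times> P" and "\<forall>x\<in>P. \<forall>y\<in>P. \<exists>z\<in>P. (x, y, z) \<in> L"
  shows "admissible P L R \<longleftrightarrow> equiv P R \<and> compatible L R"
proof
  assume adm: "admissible P L R"
  then have "equiv P R"
    unfolding admissible_def by blast
  then show "equiv P R \<and> compatible L R"
    using admissible_imp_compatible[OF assms(1) adm] by blast
qed (use compatible_imp_admissible[OF assms] in blast)

lemma sim_rel_mono:
  assumes "approx_rel P L i \<subseteq> approx_rel P L j"
  shows "sim_rel P L (Suc i) \<subseteq> sim_rel P L (Suc j)"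
proof (rule subrelI)
  fix x x' assume "(x, x') \<in> sim_rel P L (Suc i)"
  then show "(x, x') \<in> sim_rel P L (Suc j)"
    using assms by simp blast
qed

lemma sim_rel_subset_approx_rel: "sim_rel P L (Suc i) \<subseteq> approx_rel P L (Suc i)"
  by (auto simp del: sim_rel.simps)

lemma approx_rel_Suc: "approx_rel P L i \<subseteq> approx_rel P L (Suc i)"
proof (induction i)
  case 0
  show ?case
    using sim_rel_subset_approx_rel[of P L 0] by auto
next
  case (Suc i)
  show ?case
    using trancl_mono_subset[OF sim_rel_mono[OF Suc]] by (simp del: sim_rel.simps)
qed

lemma approx_rel_mono: "i \<le> j \<Longrightarrow> approx_rel P L i \<subseteq> approx_rel P L j"
  by (rule lift_Suc_mono_le[of "approx_rel P L", OF approx_rel_Suc])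

lemma approx_rel_Suc_collinear:
  assumes "L \<subseteq> P \<times> P \<times> P" "(u, v, x) \<in> L" "(u', v', x') \<in> L"
    and "(u, u') \<in> approx_rel P L i" "(v, v') \<in> approx_rel P L i"
  shows "(x, x') \<in> approx_rel P L (Suc i)"
proof -
  have "u \<in> P" "v \<in> P" "x \<in> P" "u' \<in> P" "v' \<in> P" "x' \<in> P"
    using assms(1-3) by auto
  then have "(x, x') \<in> sim_rel P L (Suc i)"
    using assms(2-) by simp blast
  then show ?thesis
    using sim_rel_subset_approx_rel by blast
qed

lemma equiv_approx_rel: "equiv P (approx_rel P L i)"
proof (induction i)
  case 0
  show ?case
    by (auto simp: equiv_def refl_on_def sym_def trans_def)
next
  case (Suc i)
  have "sym (approx_rel P L i)"
    using Suc by (rule equivE)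
  then have "sym (sim_rel P L (Suc i))"
    unfolding sym_def by simp blast
  moreover have "approx_rel P L (Suc i) \<subseteq> P \<times> P"
    by (simp del: sim_rel.simps, rule trancl_subset_Sigma) auto
  moreover have "(x, x) \<in> approx_rel P L (Suc i)" if "x \<in> P" for x
    using that sim_rel_subset_approx_rel[of P L i] by auto
  ultimately show ?case
    by (auto intro!: equivI refl_onI sym_trancl simp del: sim_rel.simps)
qed

text \<open>Transitivity and compatibility of the union both rest on this: since the stages
  increase, two related pairs already occur together in one of them.\<close>

lemma approx_union_common_stage:
  assumes "(x, x') \<in> approx_union P L" "(y, y') \<in> approx_union P L"
  obtains i where "(x, x') \<in> approx_rel P L i" "(y, y') \<in> approx_rel P L i"
proof -
  obtain j k where "(x, x') \<in> approx_rel P L j" "(y, y') \<in> approx_rel P L k"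
    using assms unfolding approx_union_def by blast
  then show ?thesis
    using that[of "max j k"] approx_rel_mono[of j "max j k" P L] approx_rel_mono[of k "max j k" P L]
    by auto
qed

lemma approx_rel_subset_approx_union: "approx_rel P L i \<subseteq> approx_union P L"
  unfolding approx_union_def by blast

lemma equiv_approx_union: "equiv P (approx_union P L)"
proof (rule equivI)
  show "approx_union P L \<subseteq> P \<times> P"
    using equiv_type[OF equiv_approx_rel, of P L] unfolding approx_union_def by blast
  show "refl_on P (approx_union P L)"
    using approx_rel_subset_approx_union[of P L 0] by (auto intro!: refl_onI)
  show "sym (approx_union P L)"
    using equiv_approx_rel[of P L] unfolding approx_union_def equiv_def sym_def by blast
  show "trans (approx_union P L)"
  proof (rule transI)
    fix x y z assume "(x, y) \<in> approx_union P L" "(y, z) \<in> approx_union P L"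
    then obtain i where "(x, y) \<in> approx_rel P L i" "(y, z) \<in> approx_rel P L i"
      by (rule approx_union_common_stage)
    then have "(x, z) \<in> approx_rel P L i"
      using equiv_approx_rel[of P L i] by (meson equivE transD)
    then show "(x, z) \<in> approx_union P L"
      using approx_rel_subset_approx_union by blast
  qed
qed

lemma compatible_approx_union:
  assumes L: "L \<subseteq> P \<times> P \<times> P"
  shows "compatible L (approx_union P L)"
  unfolding compatible_def
proof (intro allI impI)
  fix u v x u' v' x'
  assume l: "(u, v, x) \<in> L" "(u', v', x') \<in> L"
    and "(u, u') \<in> approx_union P L" "(v, v') \<in> approx_union P L"
  then obtain i where "(u, u') \<in> approx_rel P L i" "(v, v') \<in> approx_rel P L i"
    using approx_union_common_stage by metis
  then have "(x, x') \<in> approx_rel P L (Suc i)"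
    by (rule approx_rel_Suc_collinear[OF L l])
  then show "(x, x') \<in> approx_union P L"
    using approx_rel_subset_approx_union by blast
qed

lemma approx_rel_subset_compatible:
  assumes eq: "equiv P R" and comp: "compatible L R"
  shows "approx_rel P L i \<subseteq> R"
proof (induction i)
  case 0
  show ?case
    using eq by (auto simp: equiv_def refl_on_def)
next
  case (Suc i)
  have "sim_rel P L (Suc i) \<subseteq> R"
  proof
    fix p assume "p \<in> sim_rel P L (Suc i)"
    then obtain x x' where p: "p = (x, x')" "x \<in> P"
      and "x = x' \<or> (\<exists>u v u' v'. (u, u') \<in> approx_rel P L i \<and> (v, v') \<in> approx_rel P L i \<and>
             (u, v, x) \<in> L \<and> (u', v', x') \<in> L)"
      by (cases p) (simp, blast)
    then show "p \<in> R"
    proof (elim disjE exE conjE)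
      assume "x = x'"
      then show ?thesis
        using p eq by (auto simp: equiv_def refl_on_def)
    next
      fix u v u' v'
      assume "(u, u') \<in> approx_rel P L i" "(v, v') \<in> approx_rel P L i"
        and l: "(u, v, x) \<in> L" "(u', v', x') \<in> L"
      then show ?thesis
        using p Suc compatibleD[OF comp l] by blast
    qed
  qed
  then have "(sim_rel P L (Suc i))\<^sup>+ \<subseteq> R\<^sup>+"
    by (rule trancl_mono_subset)
  also have "R\<^sup>+ = R"
    using eq by (meson equivE trancl_id)
  finally show ?case
    by (simp del: sim_rel.simps)
qed

theorem theorem3p3:
  fixes P :: "'a set" and L :: "('a \<times> 'a \<times> 'a) set"
  assumes "abstract_cubic P L"
    and "\<forall>x\<in>P. \<forall>y\<in>P. \<exists>z\<in>P. (x, y, z) \<in> L"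
  shows "(\<forall>i x x'. (x, x') \<in> approx_rel P L i \<longrightarrow> (x, x') \<in> approx_rel P L (Suc i)) \<and>
         equiv P (approx_union P L) \<and>
         admissible P L (approx_union P L) \<and>
         universal P L (approx_union P L)"
proof -
  have L: "L \<subseteq> P \<times> P \<times> P"
    using assms(1) unfolding abstract_cubic_def by blast
  note adm_iff = admissible_iff[OF L assms(2)]
  have adm: "admissible P L (approx_union P L)"
    using adm_iff equiv_approx_union compatible_approx_union[OF L] by blast
  have "approx_union P L \<subseteq> R" if "admissible P L R" for R
    using that adm_iff approx_rel_subset_compatible unfolding approx_union_def by blast
  then have "universal P L (approx_union P L)"
    using adm unfolding universal_def by blast
  then show ?thesis
    using approx_rel_Suc[of P L] equiv_approx_union adm by blast
qed

end
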